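(* The system with axioms L1 $=i(i(x,y),i(i(y,z),i(x,z)))$, L2 $=i(i(n(x),x),x)$, L3 $=i(x,i(n(x),y))$ and condensed detachment as sole rule of inference admits strong double-negation elimination.
   Context: Formulas are terms built from propositional variables using the binary connective $i$ (implication) and the unary connective $n$ (negation). Condensed detachment: from a major premiss $i(A,B)$ and a minor premiss $C$, after renaming variables so that the two premisses share no variables, if $A$ and $C$ are unifiable with most general unifier $\sigma$, infer $B\sigma$. Alphabetic variants of axioms count as axioms, and conclusions may be renamed. A proof is a finite sequence of formulas each an axiom or obtained from earlier lines by the rule; deduced steps are the non-axiom lines. Given a formula $B$, a formula $B^*$ is obtained from $B$ by selecting some set of doubly negated subformulas $n(n(q))$ of $B$ and replacing all occurrences of each selected subformula by $q$. A system admits strong double-negation elimination if whenever it proves $B$ and $B^*$ is obtained from $B$ in this way, there is a proof of $B^*$ in the system in which every subformula of the form $n(n(t))$ of a deduced step occurs (up to renaming of variables) as a subformula of $B^*$. *)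

theory Defs
  imports Main
begin

datatype form = Var nat | I form form | N form

primrec subst :: "(nat \<Rightarrow> form) \<Rightarrow> form \<Rightarrow> form" where
  "subst \<sigma> (Var v) = \<sigma> v"
| "subst \<sigma> (I a b) = I (subst \<sigma> a) (subst \<sigma> b)"
| "subst \<sigma> (N a) = N (subst \<sigma> a)"

primrec vars :: "form \<Rightarrow> nat set" where
  "vars (Var v) = {v}"
| "vars (I a b) = vars a \<union> vars b"
| "vars (N a) = vars a"

primrec subforms :: "form \<Rightarrow> form set" where
  "subforms (Var v) = {Var v}"
| "subforms (I a b) = insert (I a b) (subforms a \<union> subforms b)"
| "subforms (N a) = insert (N a) (subforms a)"

definition variant :: "form \<Rightarrow> form \<Rightarrow> bool" where
  "variant A B \<longleftrightarrow> (\<exists>\<sigma> \<tau>. subst \<sigma> A = B \<and> subst \<tau> B = A)"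

definition is_mgu :: "(nat \<Rightarrow> form) \<Rightarrow> form \<Rightarrow> form \<Rightarrow> bool" where
  "is_mgu \<sigma> A C \<longleftrightarrow> subst \<sigma> A = subst \<sigma> C \<and>
     (\<forall>\<theta>. subst \<theta> A = subst \<theta> C \<longrightarrow> (\<exists>\<delta>. \<forall>x. \<theta> x = subst \<delta> (\<sigma> x)))"

definition cd :: "form \<Rightarrow> form \<Rightarrow> form \<Rightarrow> bool" where
  "cd M m R \<longleftrightarrow> (\<exists>A B C \<sigma>. variant (I A B) M \<and> variant C m \<and>
      vars (I A B) \<inter> vars C = {} \<and> is_mgu \<sigma> A C \<and> variant R (subst \<sigma> B))"

definition axiom_variant :: "form set \<Rightarrow> form \<Rightarrow> bool" where
  "axiom_variant Ax F \<longleftrightarrow> (\<exists>A\<in>Ax. variant F A)"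

definition is_proof :: "form set \<Rightarrow> form list \<Rightarrow> bool" where
  "is_proof Ax ps \<longleftrightarrow> (\<forall>i<length ps. axiom_variant Ax (ps ! i) \<or>
      (\<exists>j k. j < i \<and> k < i \<and> cd (ps ! j) (ps ! k) (ps ! i)))"

definition provable :: "form set \<Rightarrow> form \<Rightarrow> bool" where
  "provable Ax B \<longleftrightarrow> (\<exists>ps. is_proof Ax ps \<and> ps \<noteq> [] \<and> last ps = B)"

definition dn_subs :: "form \<Rightarrow> form set" where
  "dn_subs B = {N (N q) | q. N (N q) \<in> subforms B}"

fun dn_star :: "form set \<Rightarrow> form \<Rightarrow> form" where
  "dn_star S (Var v) = Var v"
| "dn_star S (I a b) = I (dn_star S a) (dn_star S b)"
| "dn_star S (N (N q)) = (if N (N q) \<in> S then dn_star S q else N (dn_star S (N q)))"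
| "dn_star S (N a) = N (dn_star S a)"

definition admits_strong_dne :: "form set \<Rightarrow> bool" where
  "admits_strong_dne Ax \<longleftrightarrow> (\<forall>B S. provable Ax B \<longrightarrow> S \<subseteq> dn_subs B \<longrightarrow>
     (\<exists>ps. is_proof Ax ps \<and> ps \<noteq> [] \<and> last ps = dn_star S B \<and>
        (\<forall>i<length ps. \<not> axiom_variant Ax (ps ! i) \<longrightarrow>
           (\<forall>t. N (N t) \<in> subforms (ps ! i) \<longrightarrow>
              (\<exists>s\<in>subforms (dn_star S B). variant s (N (N t)))))))"


definition L1 :: form where "L1 = I (I (Var 0) (Var 1)) (I (I (Var 1) (Var 2)) (I (Var 0) (Var 2)))"
definition L2 :: form where "L2 = I (I (N (Var 0)) (Var 0)) (Var 0)"
definition L3 :: form where "L3 = I (Var 0) (I (N (Var 0)) (Var 1))"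

end

theory Submission
  imports Defs
begin

text \<open>
  Double negations are avoided by semantics rather than by transforming the given proof. Since
  \<open>B\<close> is provable it is a tautology, hence so is \<open>B*\<close>. It therefore suffices to derive every
  tautology \<open>C\<close> with deduced steps whose double negations all occur in \<open>C\<close>.

  First, every substitution instance of a derivable formula is derivable without introducing foreign
  double negations: \<open>i(A, A)\<close> can be obtained exactly, for every formula \<open>A\<close>, from finitely
  many double-negation-free theorems, and detaching \<open>F\<close> from \<open>i(F\<sigma>, F\<sigma>)\<close> gives
  \<open>F\<sigma>\<close>. So modus ponens and substitution become available. Second, Kalmar's completeness
  proof is carried out with \<open>i(A, C)\<close> in the role of the negation of \<open>A\<close>; then it needs no
  negations except those occurring in \<open>C\<close>.
\<close>

section \<open>Condensed detachment\<close>

lemma subst_subst: "subst \<delta> (subst \<sigma> A) = subst (\<lambda>x. subst \<delta> (\<sigma> x)) A"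
  by (induction A) auto

lemma subst_Var [simp]: "subst Var A = A"
  by (induction A) auto

lemma subst_cong_vars: "(\<And>x. x \<in> vars A \<Longrightarrow> \<sigma> x = \<tau> x) \<Longrightarrow> subst \<sigma> A = subst \<tau> A"
  by (induction A) auto

lemma subst_eq_on_vars: "subst \<sigma> A = subst \<tau> A \<Longrightarrow> x \<in> vars A \<Longrightarrow> \<sigma> x = \<tau> x"
  by (induction A) auto

lemma subst_ident: "(\<And>x. x \<in> vars A \<Longrightarrow> \<sigma> x = Var x) \<Longrightarrow> subst \<sigma> A = A"
  using subst_cong_vars[of A \<sigma> Var] by simp

lemma vars_subst: "vars (subst \<sigma> A) = (\<Union>x\<in>vars A. vars (\<sigma> x))"
  by (induction A) auto

lemma finite_vars [simp]: "finite (vars A)"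
  by (induction A) auto

lemma variant_refl: "variant A A"
  unfolding variant_def by (metis subst_Var)

text \<open>
  Principality of a conclusion, with one substitution per premise instead of a renaming apart.
  In the proof, variables of the major premise are renamed to residue 0 modulo 3 and those of the
  minor premise to residue 1; residue 2 receives all variables irrelevant to the inference, so
  that the unifier is most general on every variable, as \<^const>\<open>is_mgu\<close> demands.
\<close>

lemma cd_principal:
  assumes unif: "subst \<theta> A = subst \<phi> C"
    and mg: "\<And>\<theta>' \<phi>'. subst \<theta>' A = subst \<phi>' C \<Longrightarrow>
      \<exists>\<delta>. (\<forall>x\<in>vars (I A B). \<theta>' x = subst \<delta> (\<theta> x)) \<and> (\<forall>x\<in>vars C. \<phi>' x = subst \<delta> (\<phi> x))"
  shows "cd (I A B) C (subst \<theta> B)"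
proof -
  define r :: "nat \<Rightarrow> nat \<Rightarrow> form" where "r i x = Var (3 * x + i)" for i x
  define s :: "nat \<Rightarrow> form" where "s y = Var (y div 3)" for y
  define \<sigma> where "\<sigma> y =
    (if y mod 3 = 0 \<and> y div 3 \<in> vars (I A B) then subst (r 0) (\<theta> (y div 3))
     else if y mod 3 = 1 \<and> y div 3 \<in> vars C then subst (r 0) (\<phi> (y div 3))
     else Var (3 * y + 2))" for y
  have inv: "subst s (subst (r i) F) = F" if "i < 3" for i F
    unfolding subst_subst using that by (intro subst_ident) (simp add: r_def s_def)
  have major: "subst \<sigma> (subst (r 0) F) = subst (r 0) (subst \<theta> F)" if "vars F \<subseteq> vars (I A B)" for F
    unfolding subst_subst using that by (intro subst_cong_vars) (auto simp: r_def \<sigma>_def)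
  have minor: "subst \<sigma> (subst (r 1) C) = subst (r 0) (subst \<phi> C)"
    unfolding subst_subst
  proof (intro subst_cong_vars)
    fix x assume "x \<in> vars C"
    moreover have "(3 * x + 1) mod 3 = 1" "(3 * x + 1) div 3 = x" by presburger+
    ultimately show "subst \<sigma> (r 1 x) = subst (r 0) (\<phi> x)" by (simp add: r_def \<sigma>_def)
  qed
  have "variant (I (subst (r 0) A) (subst (r 0) B)) (I A B)"
    unfolding variant_def by (rule exI[of _ s], rule exI[of _ "r 0"]) (simp add: inv)
  moreover have "variant (subst (r 1) C) C"
    unfolding variant_def by (rule exI[of _ s], rule exI[of _ "r 1"]) (simp add: inv)
  moreover have "vars (I (subst (r 0) A) (subst (r 0) B)) \<inter> vars (subst (r 1) C) = {}"
    by (auto simp: vars_subst r_def) presburger+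
  moreover have "is_mgu \<sigma> (subst (r 0) A) (subst (r 1) C)"
    unfolding is_mgu_def
  proof (intro conjI allI impI)
    show "subst \<sigma> (subst (r 0) A) = subst \<sigma> (subst (r 1) C)"
      using major[of A] minor unif by simp
  next
    fix \<theta>' assume "subst \<theta>' (subst (r 0) A) = subst \<theta>' (subst (r 1) C)"
    then obtain \<delta> where
      \<delta>: "\<And>x. x \<in> vars (I A B) \<Longrightarrow> \<theta>' (3 * x) = subst \<delta> (\<theta> x)"
         "\<And>x. x \<in> vars C \<Longrightarrow> \<theta>' (3 * x + 1) = subst \<delta> (\<phi> x)"
      unfolding subst_subst using mg[of "\<lambda>x. \<theta>' (3 * x)" "\<lambda>x. \<theta>' (3 * x + 1)"]
      by (auto simp: r_def)
    \<comment> \<open>Residue 0 carries the variables of the unified terms, so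
      \<open>\<delta>\<close> acts there after decoding. Elsewhere \<open>\<theta>'\<close> is read
      at the decoded index, which recovers a parked variable \<open>y\<close> from
      \<open>3 * y + 2\<close>.\<close>
    define \<delta>' where "\<delta>' y = (if y mod 3 = 0 then \<delta> (y div 3) else \<theta>' (y div 3))" for y
    have lift: "subst \<delta>' (subst (r 0) F) = subst \<delta> F" for F
      unfolding subst_subst by (intro subst_cong_vars) (simp add: r_def \<delta>'_def)
    have "\<theta>' y = subst \<delta>' (\<sigma> y)" for y
    proof -
      consider "y mod 3 = 0" "y div 3 \<in> vars (I A B)" | "y mod 3 = 1" "y div 3 \<in> vars C"
        | "\<sigma> y = Var (3 * y + 2)"
        unfolding \<sigma>_def by metis
      then show ?thesis
      proof cases
        case 1
        then have "\<theta>' y = subst \<delta> (\<theta> (y div 3))" using \<delta>(1)[of "y div 3"] by auto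
        then show ?thesis using 1 by (simp add: \<sigma>_def lift)
      next
        case 2
        moreover from 2 have "3 * (y div 3) + 1 = y" by presburger
        ultimately have "\<theta>' y = subst \<delta> (\<phi> (y div 3))" using \<delta>(2)[of "y div 3"] by auto
        then show ?thesis using 2 by (simp add: \<sigma>_def lift)
      next
        case 3
        moreover have "(3 * y + 2) mod 3 \<noteq> 0" "(3 * y + 2) div 3 = y" by presburger+
        ultimately show ?thesis by (simp add: \<delta>'_def)
      qed
    qed
    then show "\<exists>\<delta>. \<forall>x. \<theta>' x = subst \<delta> (\<sigma> x)" by blast
  qed
  moreover have "variant (subst \<theta> B) (subst \<sigma> (subst (r 0) B))"
    unfolding variant_def using major[of B] inv[of 0 "subst \<theta> B"]
    by (intro exI[of _ "r 0"] exI[of _ s]) simp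
  ultimately show ?thesis unfolding cd_def by blast
qed

text \<open>Unification is one-sided matching here: the antecedent is already an instance of the
  minor premiss, so leaving the major premiss unchanged is most general and \<open>B\<close> comes
  out exactly.\<close>

lemma cd_minor_general: "cd (I (subst \<phi> C) B) C B"
proof -
  have "cd (I (subst \<phi> C) B) C (subst Var B)"
  proof (rule cd_principal[where \<phi> = \<phi>])
    fix \<theta>' \<phi>' assume "subst \<theta>' (subst \<phi> C) = subst \<phi>' C"
    from subst_eq_on_vars[OF this[unfolded subst_subst]]
    show "\<exists>\<delta>. (\<forall>x\<in>vars (I (subst \<phi> C) B). \<theta>' x = subst \<delta> (Var x)) \<and>
        (\<forall>x\<in>vars C. \<phi>' x = subst \<delta> (\<phi> x))"
      by (intro exI[of _ \<theta>']) auto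
  qed simp
  then show ?thesis by simp
qed

text \<open>The dual matching. Variables occurring only in \<open>B\<close> are unconstrained, so a
  most general conclusion must keep them distinct from each other and from those of the minor
  premiss; hence \<open>fresh\<close> and \<open>inj\<close>.\<close>

lemma cd_major_general:
  assumes fresh: "\<And>x. x \<in> vars B - vars A \<Longrightarrow> \<sigma> x = Var (f x) \<and> f x \<notin> vars (subst \<sigma> A)"
    and inj: "inj_on f (vars B - vars A)"
  shows "cd (I A B) (subst \<sigma> A) (subst \<sigma> B)"
proof (rule cd_principal[where \<phi> = Var])
  fix \<theta>' \<phi>'
  assume eq: "subst \<theta>' A = subst \<phi>' (subst \<sigma> A)"
  \<comment> \<open>On fresh variables the factor undoes \<open>f\<close> and follows
    \<open>\<theta>'\<close>; on variables of the minor premiss it has to agree with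
    \<open>\<phi>'\<close>.\<close>
  define \<delta> where "\<delta> y = (if y \<in> f ` (vars B - vars A)
    then \<theta>' (inv_into (vars B - vars A) f y) else \<phi>' y)" for y
  have old: "\<delta> y = \<phi>' y" if "y \<in> vars (subst \<sigma> A)" for y
    using that fresh by (auto simp: \<delta>_def)
  have "\<theta>' x = subst \<delta> (\<sigma> x)" if "x \<in> vars A" for x
  proof -
    have "\<theta>' x = subst \<phi>' (\<sigma> x)"
      using subst_eq_on_vars[OF eq[unfolded subst_subst] that] .
    also have "\<dots> = subst \<delta> (\<sigma> x)"
      using that by (intro subst_cong_vars old[symmetric]) (auto simp: vars_subst)
    finally show ?thesis .
  qed
  moreover have "\<theta>' x = subst \<delta> (\<sigma> x)" if "x \<in> vars B - vars A" for x
    using that fresh[OF that] inj by (auto simp: \<delta>_def)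
  ultimately have "\<forall>x\<in>vars (I A B). \<theta>' x = subst \<delta> (\<sigma> x)" by auto
  then show "\<exists>\<delta>. (\<forall>x\<in>vars (I A B). \<theta>' x = subst \<delta> (\<sigma> x)) \<and>
      (\<forall>x\<in>vars (subst \<sigma> A). \<phi>' x = subst \<delta> (Var x))"
    using old by (intro exI[of _ \<delta>]) auto
qed simp

section \<open>Unification and an executable form of condensed detachment\<close>

text \<open>The first argument is fuel: running out of it yields \<^const>\<open>None\<close>, like a clash.\<close>

fun unify :: "nat \<Rightarrow> (form \<times> form) list \<Rightarrow> (nat \<times> form) list option" where
  "unify _ [] = Some []"
| "unify 0 _ = None"
| "unify (Suc n) ((I a b, I c d) # E) = unify n ((a, c) # (b, d) # E)"
| "unify (Suc n) ((N a, N b) # E) = unify n ((a, b) # E)"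
| "unify (Suc n) ((Var x, t) # E) =
    (if t = Var x then unify n E
     else if x \<in> vars t then None
     else map_option ((#) (x, t))
       (unify n (map (map_prod (subst (Var(x := t))) (subst (Var(x := t)))) E)))"
| "unify (Suc n) ((t, Var x) # E) = unify n ((Var x, t) # E)"
| "unify _ _ = None"

text \<open>Bindings are triangular: the tail may still instantiate variables in the term of the
  head binding, hence the composition.\<close>

primrec solved :: "(nat \<times> form) list \<Rightarrow> nat \<Rightarrow> form" where
  "solved [] = Var"
| "solved (p # \<sigma>) = (\<lambda>x. subst (solved \<sigma>) ((Var(fst p := snd p)) x))"

text \<open>The factor witnessing generality is \<open>\<theta>\<close> itself. In this form
  generality passes through variable elimination without composing witnesses.\<close>

lemma unify_sound:
  assumes "unify n E = Some \<sigma>"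
  shows "\<forall>(s, t)\<in>set E. subst (solved \<sigma>) s = subst (solved \<sigma>) t"
    and "(\<forall>(s, t)\<in>set E. subst \<theta> s = subst \<theta> t) \<Longrightarrow> (\<lambda>x. subst \<theta> (solved \<sigma> x)) = \<theta>"
proof -
  have "(\<forall>(s, t)\<in>set E. subst (solved \<sigma>) s = subst (solved \<sigma>) t) \<and>
    ((\<forall>(s, t)\<in>set E. subst \<theta> s = subst \<theta> t) \<longrightarrow> (\<lambda>x. subst \<theta> (solved \<sigma> x)) = \<theta>)"
    using assms
  proof (induction n E arbitrary: \<sigma> rule: unify.induct)
    case (5 n y t E)
    show ?case
    proof (cases "t = Var y")
      case True
      then show ?thesis using 5 by auto
    next
      case False
      let ?u = "subst (Var(y := t))"
      from False 5 obtain \<tau> where y: "y \<notin> vars t" and \<sigma>: "\<sigma> = (y, t) # \<tau>"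
        and \<tau>: "unify n (map (map_prod ?u ?u) E) = Some \<tau>"
        by (auto split: if_splits)
      note IH = "5.IH"(2)[OF False y \<tau>]
      have comp: "subst (solved \<sigma>) s = subst (solved \<tau>) (?u s)" for s
        unfolding \<sigma> by (simp add: subst_subst)
      have "?u t = t" using y by (intro subst_ident) auto
      then have 1: "\<forall>(s, s')\<in>set ((Var y, t) # E). subst (solved \<sigma>) s = subst (solved \<sigma>) s'"
        using IH by (fastforce simp: comp)
      have 2: "(\<lambda>x. subst \<theta> (solved \<sigma> x)) = \<theta>"
        if uni: "\<forall>(s, s')\<in>set ((Var y, t) # E). subst \<theta> s = subst \<theta> s'"
      proof -
        \<comment> \<open>\<open>\<theta>\<close> already equates \<open>Var y\<close> with
          \<open>t\<close>, so eliminating \<open>y\<close> first does not change it, and it unifies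
          the remaining equations too.\<close>
        have \<theta>: "(\<lambda>x. subst \<theta> ((Var(y := t)) x)) = \<theta>" using uni by auto
        then have "subst \<theta> (?u s) = subst \<theta> s" for s
          by (simp only: subst_subst)
        moreover have "subst \<theta> a = subst \<theta> b" if "(a, b) \<in> set E" for a b
          using uni that by auto
        ultimately have "\<forall>(s, s')\<in>set (map (map_prod ?u ?u) E). subst \<theta> s = subst \<theta> s'"
          by auto
        then have "(\<lambda>x. subst \<theta> (solved \<tau> x)) = \<theta>" using IH by auto
        then show ?thesis using \<theta> unfolding \<sigma> by (simp add: subst_subst)
      qed
      show ?thesis using 1 2 by blast
    qed
  qed auto
  then show "\<forall>(s, t)\<in>set E. subst (solved \<sigma>) s = subst (solved \<sigma>) t"
    and "(\<forall>(s, t)\<in>set E. subst \<theta> s = subst \<theta> t) \<Longrightarrow> (\<lambda>x. subst \<theta> (solved \<sigma> x)) = \<theta>"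
    by blast+
qed

text \<open>The order is right to left because \<open>remdups\<close> keeps last entries: after
  reversal, distinct variables stand in order of leftmost occurrence.\<close>

primrec rev_var_list :: "form \<Rightarrow> nat list" where
  "rev_var_list (Var v) = [v]"
| "rev_var_list (I a b) = rev_var_list b @ rev_var_list a"
| "rev_var_list (N a) = rev_var_list a"

lemma set_rev_var_list [simp]: "set (rev_var_list A) = vars A"
  by (induction A) auto

lemma variant_rename:
  assumes "inj_on f (vars A)"
  shows "variant (subst (\<lambda>x. Var (f x)) A) A"
  unfolding variant_def
proof (intro exI conjI)
  show "subst (\<lambda>y. Var (inv_into (vars A) f y)) (subst (\<lambda>x. Var (f x)) A) = A"
    unfolding subst_subst using assms by (intro subst_ident) simp
qed simp

text \<open>A canonical numbering makes computed conclusions coincide literally with formulas whose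
  variables first appear in the order 0, 1, 2 and so on.\<close>

definition normalize :: "form \<Rightarrow> form" where
  "normalize A = subst (\<lambda>x. Var (length (takeWhile ((\<noteq>) x) (rev (remdups (rev_var_list A)))))) A"

lemma variant_normalize: "variant (normalize A) A"
  unfolding normalize_def
proof (intro variant_rename inj_onI)
  let ?xs = "rev (remdups (rev_var_list A))"
  fix x y assume xy: "x \<in> vars A" "y \<in> vars A"
    and eq: "length (takeWhile ((\<noteq>) x) ?xs) = length (takeWhile ((\<noteq>) y) ?xs)"
  have "z \<in> set xs \<Longrightarrow> xs ! length (takeWhile ((\<noteq>) z) xs) = z" for z and xs :: "nat list"
    by (induction xs) auto
  then have "?xs ! length (takeWhile ((\<noteq>) z) ?xs) = z" if "z \<in> vars A" for z
    using that by simp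
  from this[OF xy(1)] this[OF xy(2)] eq show "x = y" by metis
qed

text \<open>The shift \<open>k\<close> exceeds every variable of the major premiss, as a list member
  is at most the sum of the list; this renames the premisses apart.\<close>

fun detach :: "nat \<Rightarrow> form \<Rightarrow> form \<Rightarrow> form option" where
  "detach n (I A B) C =
    (let k = Suc (sum_list (rev_var_list (I A B)))
     in map_option (\<lambda>\<sigma>. normalize (subst (solved \<sigma>) B))
          (unify n [(A, subst (\<lambda>x. Var (x + k)) C)]))"
| "detach n _ _ = None"

lemma detach_cd:
  assumes "detach n M m = Some R"
  shows "cd M m R"
proof -
  obtain A B where M: "M = I A B"
    using assms by (cases M) auto
  define k where "k = Suc (sum_list (rev_var_list M))"
  define C where "C = subst (\<lambda>x. Var (x + k)) m"
  obtain \<sigma> where unify: "unify n [(A, C)] = Some \<sigma>" and R: "R = normalize (subst (solved \<sigma>) B)"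
    using assms unfolding M k_def C_def by (auto simp: Let_def)
  have "x < k" if "x \<in> vars M" for x
    using member_le_sum_list[of x "rev_var_list M"] that by (simp add: k_def less_Suc_eq_le)
  then have "vars M \<inter> vars C = {}"
    by (fastforce simp: C_def vars_subst)
  moreover have "variant C m"
    unfolding C_def by (rule variant_rename) (simp add: inj_on_def)
  moreover have "is_mgu (solved \<sigma>) A C"
    unfolding is_mgu_def
  proof (intro conjI allI impI)
    show "subst (solved \<sigma>) A = subst (solved \<sigma>) C"
      using unify_sound(1)[OF unify] by simp
  next
    fix \<theta> assume "subst \<theta> A = subst \<theta> C"
    then have "(\<lambda>x. subst \<theta> (solved \<sigma> x)) = \<theta>"
      by (intro unify_sound(2)[OF unify]) simp
    then show "\<exists>\<delta>. \<forall>x. \<theta> x = subst \<delta> (solved \<sigma> x)" by metis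
  qed
  ultimately show ?thesis
    unfolding cd_def M R using variant_refl variant_normalize by blast
qed

section \<open>Theorems with double-negation-free derivations\<close>

notation I (infixr "\<rightarrow>" 60)

fun dn_free :: "form \<Rightarrow> bool" where
  "dn_free (Var x) = True"
| "dn_free (I A B) = (dn_free A \<and> dn_free B)"
| "dn_free (N (N A)) = False"
| "dn_free (N A) = dn_free A"

text \<open>\<open>Ds\<close> is the supply of permitted double negations, in the end the
  subformulas of \<open>dn_star S B\<close>.\<close>

definition dn_ok :: "form set \<Rightarrow> form \<Rightarrow> bool" where
  "dn_ok Ds A \<longleftrightarrow> (\<forall>t. N (N t) \<in> subforms A \<longrightarrow> (\<exists>s\<in>Ds. variant s (N (N t))))"

lemma dn_free_iff: "dn_free A \<longleftrightarrow> (\<forall>t. N (N t) \<notin> subforms A)"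
  by (induction A rule: dn_free.induct) auto

lemma dn_ok_I [simp]: "dn_ok Ds (I A B) \<longleftrightarrow> dn_ok Ds A \<and> dn_ok Ds B"
  unfolding dn_ok_def by auto

lemma dn_ok_N: "dn_ok Ds (N A) \<Longrightarrow> dn_ok Ds A"
  unfolding dn_ok_def by auto

lemma dn_ok_Var [simp]: "dn_ok Ds (Var x)"
  unfolding dn_ok_def by auto

lemma dn_free_ok: "dn_free A \<Longrightarrow> dn_ok Ds A"
  by (simp add: dn_free_iff dn_ok_def)

inductive derivable :: "form set \<Rightarrow> form \<Rightarrow> bool" for Ds where
  ax: "axiom_variant {L1, L2, L3} A \<Longrightarrow> derivable Ds A"
| cd: "derivable Ds M \<Longrightarrow> derivable Ds m \<Longrightarrow> cd M m R \<Longrightarrow> dn_ok Ds R \<Longrightarrow> derivable Ds R"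

lemma derivable_axiom: "A \<in> {L1, L2, L3} \<Longrightarrow> derivable Ds A"
  by (rule derivable.ax) (auto simp: axiom_variant_def intro: variant_refl)

text \<open>Reduces a step to evaluation on concrete formulas. A result free of double negations is
  admissible for every \<open>Ds\<close>, so one computation serves them all.\<close>

lemma derivable_detach:
  assumes "derivable Ds M" "derivable Ds m" "detach 100 M m = Some R \<and> dn_free R"
  shows "derivable Ds R"
  using assms by (auto intro: derivable.cd[OF assms(1,2)] detach_cd dn_free_ok)

text \<open>
  The derivation of weakening (16), contraction (24) and commutation (28) is essentially
  Lukasiewicz's; the formulas after (28) are principal types of combinators built from these.
\<close>

lemma luk:
  shows luk_id: "derivable Ds (Var 0 \<rightarrow> Var 0)"
    and luk_id_id: "derivable Ds ((Var 0 \<rightarrow> Var 0) \<rightarrow> Var 0 \<rightarrow> Var 0)"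
    and luk_const: "derivable Ds (Var 0 \<rightarrow> Var 1 \<rightarrow> Var 0)"
    and luk_trans: "derivable Ds ((Var 0 \<rightarrow> Var 1) \<rightarrow> (Var 1 \<rightarrow> Var 2) \<rightarrow> Var 0 \<rightarrow> Var 2)"
    and luk_distr: "derivable Ds ((Var 0 \<rightarrow> Var 1 \<rightarrow> Var 2) \<rightarrow> (Var 0 \<rightarrow> Var 1) \<rightarrow> Var 0 \<rightarrow> Var 2)"
    and luk_apply: "derivable Ds (Var 0 \<rightarrow> (Var 0 \<rightarrow> Var 1) \<rightarrow> Var 1)"
    and luk_contr: "derivable Ds (N (Var 0) \<rightarrow> Var 0 \<rightarrow> Var 1)"
    and luk_cases: "derivable Ds ((Var 0 \<rightarrow> Var 1) \<rightarrow> (N (Var 0) \<rightarrow> Var 1) \<rightarrow> Var 1)"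
    and luk_tarski: "derivable Ds ((Var 0 \<rightarrow> Var 1) \<rightarrow> ((Var 0 \<rightarrow> Var 2) \<rightarrow> Var 1) \<rightarrow> Var 1)"
    and luk_weaken: "derivable Ds (Var 0 \<rightarrow> (Var 1 \<rightarrow> Var 1) \<rightarrow> Var 0)"
    and luk_intro_id: "derivable Ds ((Var 0 \<rightarrow> Var 1) \<rightarrow> Var 0 \<rightarrow> Var 2 \<rightarrow> Var 2)"
    and luk_drop_id: "derivable Ds ((Var 0 \<rightarrow> Var 1) \<rightarrow> ((Var 2 \<rightarrow> Var 2) \<rightarrow> Var 0) \<rightarrow> Var 1)"
    and luk_shift_id: "derivable Ds ((Var 0 \<rightarrow> Var 1 \<rightarrow> Var 1) \<rightarrow> ((Var 1 \<rightarrow> Var 1) \<rightarrow> Var 0) \<rightarrow> Var 1 \<rightarrow> Var 1)"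
    and luk_neg_mono: "derivable Ds ((Var 0 \<rightarrow> Var 1 \<rightarrow> Var 2) \<rightarrow> Var 0 \<rightarrow> N (Var 2) \<rightarrow> N (Var 1))"
    and luk_imp_mono: "derivable Ds ((Var 0 \<rightarrow> Var 1 \<rightarrow> Var 2) \<rightarrow> (Var 0 \<rightarrow> Var 3 \<rightarrow> Var 4) \<rightarrow> Var 0 \<rightarrow> (Var 2 \<rightarrow> Var 3) \<rightarrow> Var 1 \<rightarrow> Var 4)"
proof -
  let ?p = "Var 0" and ?q = "Var 1" and ?r = "Var 2" and ?s = "Var 3" and ?t = "Var 4" and ?u = "Var 5"
  have 1: "derivable Ds ((?p \<rightarrow> ?q) \<rightarrow> (?q \<rightarrow> ?r) \<rightarrow> ?p \<rightarrow> ?r)"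
    by (rule derivable_axiom) (simp add: L1_def L2_def L3_def)
  have 2: "derivable Ds ((N ?p \<rightarrow> ?p) \<rightarrow> ?p)"
    by (rule derivable_axiom) (simp add: L1_def L2_def L3_def)
  have 3: "derivable Ds (?p \<rightarrow> N ?p \<rightarrow> ?q)"
    by (rule derivable_axiom) (simp add: L1_def L2_def L3_def)
  have 4: "derivable Ds (((N ?p \<rightarrow> ?q) \<rightarrow> ?r) \<rightarrow> ?p \<rightarrow> ?r)"
    by (rule derivable_detach[OF 1 3]; code_simp)
  have 5: "derivable Ds ((((?p \<rightarrow> ?q) \<rightarrow> ?r \<rightarrow> ?q) \<rightarrow> ?s) \<rightarrow> (?r \<rightarrow> ?p) \<rightarrow> ?s)"
    by (rule derivable_detach[OF 1 1]; code_simp)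
  have 6: "derivable Ds ((?p \<rightarrow> N ?q) \<rightarrow> ?q \<rightarrow> ?p \<rightarrow> ?r)"
    by (rule derivable_detach[OF 5 4]; code_simp)
  have 7: "derivable Ds (((?p \<rightarrow> ?q \<rightarrow> ?r) \<rightarrow> ?s) \<rightarrow> (?q \<rightarrow> N ?p) \<rightarrow> ?s)"
    by (rule derivable_detach[OF 1 6]; code_simp)
  have 8: "derivable Ds ((?p \<rightarrow> N ?q) \<rightarrow> ((?p \<rightarrow> ?r) \<rightarrow> ?s) \<rightarrow> ?q \<rightarrow> ?s)"
    by (rule derivable_detach[OF 7 1]; code_simp)
  have 9: "derivable Ds (?p \<rightarrow> ((N ?p \<rightarrow> ?q) \<rightarrow> ?r) \<rightarrow> ?s \<rightarrow> ?r)"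
    by (rule derivable_detach[OF 4 8]; code_simp)
  have 10: "derivable Ds (((N ((N ?p \<rightarrow> ?p) \<rightarrow> ?p) \<rightarrow> ?q) \<rightarrow> ?r) \<rightarrow> ?s \<rightarrow> ?r)"
    by (rule derivable_detach[OF 9 2]; code_simp)
  have 11: "derivable Ds (?p \<rightarrow> (N ?q \<rightarrow> ?q) \<rightarrow> ?q)"
    by (rule derivable_detach[OF 10 2]; code_simp)
  have 12: "derivable Ds ((((N ?p \<rightarrow> ?p) \<rightarrow> ?p) \<rightarrow> ?q) \<rightarrow> ?r \<rightarrow> ?q)"
    by (rule derivable_detach[OF 1 11]; code_simp)
  have 13: "derivable Ds (((?p \<rightarrow> ?q) \<rightarrow> ?r) \<rightarrow> (((N ?s \<rightarrow> ?s) \<rightarrow> ?s) \<rightarrow> ?q) \<rightarrow> ?r)"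
    by (rule derivable_detach[OF 1 12]; code_simp)
  have 14: "derivable Ds ((((N ?p \<rightarrow> ?p) \<rightarrow> ?p) \<rightarrow> ?q) \<rightarrow> ?q)"
    by (rule derivable_detach[OF 13 2]; code_simp)
  have 15: "derivable Ds (((((N ?p \<rightarrow> ?q) \<rightarrow> ?r) \<rightarrow> ?s \<rightarrow> ?r) \<rightarrow> ?t) \<rightarrow> ?p \<rightarrow> ?t)"
    by (rule derivable_detach[OF 1 9]; code_simp)
  have 16: "derivable Ds (?p \<rightarrow> ?q \<rightarrow> ?p)"
    by (rule derivable_detach[OF 15 14]; code_simp)
  have 17: "derivable Ds (((?p \<rightarrow> ?q) \<rightarrow> ?r) \<rightarrow> ?q \<rightarrow> ?r)"
    by (rule derivable_detach[OF 1 16]; code_simp)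
  have 18: "derivable Ds (N ?p \<rightarrow> ((?q \<rightarrow> ?r) \<rightarrow> ?s) \<rightarrow> ?p \<rightarrow> ?s)"
    by (rule derivable_detach[OF 17 8]; code_simp)
  have 19: "derivable Ds (((((?p \<rightarrow> ?q) \<rightarrow> ?r) \<rightarrow> ?s \<rightarrow> ?r) \<rightarrow> ?t) \<rightarrow> N ?s \<rightarrow> ?t)"
    by (rule derivable_detach[OF 1 18]; code_simp)
  have 20: "derivable Ds (N ?p \<rightarrow> ?p \<rightarrow> ?q)"
    by (rule derivable_detach[OF 19 14]; code_simp)
  have 21: "derivable Ds (((?p \<rightarrow> ?q) \<rightarrow> ?r) \<rightarrow> N ?p \<rightarrow> ?r)"
    by (rule derivable_detach[OF 1 20]; code_simp)
  have 22: "derivable Ds (((N ?p \<rightarrow> ?q) \<rightarrow> ?r) \<rightarrow> ((?p \<rightarrow> ?s) \<rightarrow> ?q) \<rightarrow> ?r)"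
    by (rule derivable_detach[OF 1 21]; code_simp)
  \<comment> \<open>Peirce's law; matched against the antecedent of 5 it yields contraction.\<close>
  have 23: "derivable Ds (((?p \<rightarrow> ?q) \<rightarrow> ?p) \<rightarrow> ?p)"
    by (rule derivable_detach[OF 22 2]; code_simp)
  have 24: "derivable Ds ((?p \<rightarrow> ?p \<rightarrow> ?q) \<rightarrow> ?p \<rightarrow> ?q)"
    by (rule derivable_detach[OF 5 23]; code_simp)
  have 25: "derivable Ds (((?p \<rightarrow> ?q) \<rightarrow> ?p) \<rightarrow> (?p \<rightarrow> ?q) \<rightarrow> ?q)"
    by (rule derivable_detach[OF 5 24]; code_simp)
  have 26: "derivable Ds (?p \<rightarrow> (?p \<rightarrow> ?q) \<rightarrow> ?q)"
    by (rule derivable_detach[OF 17 25]; code_simp)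
  have 27: "derivable Ds ((((?p \<rightarrow> ?q) \<rightarrow> ?q) \<rightarrow> ?r) \<rightarrow> ?p \<rightarrow> ?r)"
    by (rule derivable_detach[OF 1 26]; code_simp)
  have 28: "derivable Ds ((?p \<rightarrow> ?q \<rightarrow> ?r) \<rightarrow> ?q \<rightarrow> ?p \<rightarrow> ?r)"
    by (rule derivable_detach[OF 5 27]; code_simp)
  have 29: "derivable Ds ((?p \<rightarrow> ?q) \<rightarrow> (?r \<rightarrow> ?p) \<rightarrow> ?r \<rightarrow> ?q)"
    by (rule derivable_detach[OF 28 1]; code_simp)
  have 30: "derivable Ds (?p \<rightarrow> ?p)"
    by (rule derivable_detach[OF 24 16]; code_simp)
  \<comment> \<open>31 to 43 manipulate identities \<open>?q \<rightarrow> ?q\<close>, in order to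
    build a formula that implies the identity of each of its variables.\<close>
  have 31: "derivable Ds (?p \<rightarrow> ?q \<rightarrow> ?q)"
    by (rule derivable_detach[OF 16 30]; code_simp)
  have 32: "derivable Ds ((?p \<rightarrow> ?p) \<rightarrow> ?p \<rightarrow> ?p)"
    by (rule derivable_detach[OF 24 1]; code_simp)
  have 33: "derivable Ds (((?p \<rightarrow> ?p) \<rightarrow> ?q) \<rightarrow> (?p \<rightarrow> ?p) \<rightarrow> ?q)"
    by (rule derivable_detach[OF 1 32]; code_simp)
  have 34: "derivable Ds ((?p \<rightarrow> ?p) \<rightarrow> ?q \<rightarrow> ?q)"
    by (rule derivable_detach[OF 33 31]; code_simp)
  have 35: "derivable Ds (?p \<rightarrow> (?q \<rightarrow> ?q) \<rightarrow> ?p)"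
    by (rule derivable_detach[OF 28 34]; code_simp)
  have 36: "derivable Ds ((?p \<rightarrow> ?q) \<rightarrow> ?p \<rightarrow> ?r \<rightarrow> ?r)"
    by (rule derivable_detach[OF 29 31]; code_simp)
  have 37: "derivable Ds (((?p \<rightarrow> ?p) \<rightarrow> ?q) \<rightarrow> ?r \<rightarrow> ?q)"
    by (rule derivable_detach[OF 1 31]; code_simp)
  have 38: "derivable Ds (((?p \<rightarrow> ?p) \<rightarrow> ?q) \<rightarrow> ?q)"
    by (rule derivable_detach[OF 24 37]; code_simp)
  have 39: "derivable Ds ((?p \<rightarrow> ?q) \<rightarrow> ((?r \<rightarrow> ?r) \<rightarrow> ?p) \<rightarrow> ?q)"
    by (rule derivable_detach[OF 1 38]; code_simp)
  have 40: "derivable Ds (((?p \<rightarrow> ?p) \<rightarrow> ?p \<rightarrow> ?p) \<rightarrow> ?p \<rightarrow> ?p)"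
    by (rule derivable_detach[OF 33 38]; code_simp)
  have 41: "derivable Ds ((?p \<rightarrow> (?q \<rightarrow> ?q) \<rightarrow> ?q \<rightarrow> ?q) \<rightarrow> ?p \<rightarrow> ?q \<rightarrow> ?q)"
    by (rule derivable_detach[OF 29 40]; code_simp)
  have 42: "derivable Ds ((((?p \<rightarrow> ?q) \<rightarrow> ?p \<rightarrow> ?r) \<rightarrow> ?s) \<rightarrow> (?q \<rightarrow> ?r) \<rightarrow> ?s)"
    by (rule derivable_detach[OF 1 29]; code_simp)
  have 43: "derivable Ds ((?p \<rightarrow> ?q \<rightarrow> ?q) \<rightarrow> ((?q \<rightarrow> ?q) \<rightarrow> ?p) \<rightarrow> ?q \<rightarrow> ?q)"
    by (rule derivable_detach[OF 42 41]; code_simp)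
  \<comment> \<open>44 to 53 lead to contraposition (52) and its version under a common antecedent
    (53).\<close>
  have 44: "derivable Ds ((?p \<rightarrow> ?q) \<rightarrow> (N ?p \<rightarrow> ?p) \<rightarrow> ?q)"
    by (rule derivable_detach[OF 1 2]; code_simp)
  have 45: "derivable Ds ((((N ?p \<rightarrow> ?p) \<rightarrow> ?q) \<rightarrow> ?r) \<rightarrow> (?p \<rightarrow> ?q) \<rightarrow> ?r)"
    by (rule derivable_detach[OF 1 44]; code_simp)
  have 46: "derivable Ds ((?p \<rightarrow> N ?p) \<rightarrow> N ?p)"
    by (rule derivable_detach[OF 45 23]; code_simp)
  have 47: "derivable Ds ((?p \<rightarrow> ?q) \<rightarrow> ?p \<rightarrow> N ?q \<rightarrow> ?r)"
    by (rule derivable_detach[OF 29 3]; code_simp)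
  have 48: "derivable Ds (((?p \<rightarrow> N ?q \<rightarrow> ?r) \<rightarrow> ?s) \<rightarrow> (?p \<rightarrow> ?q) \<rightarrow> ?s)"
    by (rule derivable_detach[OF 1 47]; code_simp)
  have 49: "derivable Ds ((?p \<rightarrow> ?q) \<rightarrow> N ?q \<rightarrow> ?p \<rightarrow> ?r)"
    by (rule derivable_detach[OF 48 28]; code_simp)
  have 50: "derivable Ds ((?p \<rightarrow> ?q \<rightarrow> N ?q) \<rightarrow> ?p \<rightarrow> N ?q)"
    by (rule derivable_detach[OF 29 46]; code_simp)
  have 51: "derivable Ds (((N ?p \<rightarrow> ?q \<rightarrow> ?r) \<rightarrow> ?s) \<rightarrow> (?q \<rightarrow> ?p) \<rightarrow> ?s)"
    by (rule derivable_detach[OF 1 49]; code_simp)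
  have 52: "derivable Ds ((?p \<rightarrow> ?q) \<rightarrow> N ?q \<rightarrow> N ?p)"
    by (rule derivable_detach[OF 51 50]; code_simp)
  have 53: "derivable Ds ((?p \<rightarrow> ?q \<rightarrow> ?r) \<rightarrow> ?p \<rightarrow> N ?r \<rightarrow> N ?q)"
    by (rule derivable_detach[OF 29 52]; code_simp)
  \<comment> \<open>54 to 63 lead to distribution (60) and to monotonicity of implication under a
    common antecedent (63).\<close>
  have 54: "derivable Ds ((?p \<rightarrow> ?q) \<rightarrow> (?r \<rightarrow> ?s \<rightarrow> ?p) \<rightarrow> ?r \<rightarrow> ?s \<rightarrow> ?q)"
    by (rule derivable_detach[OF 42 29]; code_simp)
  have 55: "derivable Ds ((?p \<rightarrow> ?q \<rightarrow> ?r) \<rightarrow> (?r \<rightarrow> ?s) \<rightarrow> ?p \<rightarrow> ?q \<rightarrow> ?s)"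
    by (rule derivable_detach[OF 28 54]; code_simp)
  have 56: "derivable Ds ((?p \<rightarrow> ?q) \<rightarrow> (?r \<rightarrow> ?s) \<rightarrow> (?q \<rightarrow> ?r) \<rightarrow> ?p \<rightarrow> ?s)"
    by (rule derivable_detach[OF 5 55]; code_simp)
  have 57: "derivable Ds ((?p \<rightarrow> ?q \<rightarrow> ?q \<rightarrow> ?r) \<rightarrow> ?p \<rightarrow> ?q \<rightarrow> ?r)"
    by (rule derivable_detach[OF 29 24]; code_simp)
  have 58: "derivable Ds ((?p \<rightarrow> ?q \<rightarrow> ?r) \<rightarrow> (?q \<rightarrow> ?p) \<rightarrow> ?q \<rightarrow> ?r)"
    by (rule derivable_detach[OF 42 57]; code_simp)
  have 59: "derivable Ds (((?p \<rightarrow> ?q \<rightarrow> ?r) \<rightarrow> ?s) \<rightarrow> (?q \<rightarrow> ?p \<rightarrow> ?r) \<rightarrow> ?s)"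
    by (rule derivable_detach[OF 1 28]; code_simp)
  have 60: "derivable Ds ((?p \<rightarrow> ?q \<rightarrow> ?r) \<rightarrow> (?p \<rightarrow> ?q) \<rightarrow> ?p \<rightarrow> ?r)"
    by (rule derivable_detach[OF 59 58]; code_simp)
  have 61: "derivable Ds ((?p \<rightarrow> ?q \<rightarrow> ?r) \<rightarrow> ?p \<rightarrow> (?s \<rightarrow> ?t) \<rightarrow> (?r \<rightarrow> ?s) \<rightarrow> ?q \<rightarrow> ?t)"
    by (rule derivable_detach[OF 29 56]; code_simp)
  have 62: "derivable Ds (((?p \<rightarrow> (?q \<rightarrow> ?r) \<rightarrow> (?s \<rightarrow> ?q) \<rightarrow> ?t \<rightarrow> ?r) \<rightarrow> ?u) \<rightarrow> (?p \<rightarrow> ?t \<rightarrow> ?s) \<rightarrow> ?u)"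
    by (rule derivable_detach[OF 1 61]; code_simp)
  have 63: "derivable Ds ((?p \<rightarrow> ?q \<rightarrow> ?r) \<rightarrow> (?p \<rightarrow> ?s \<rightarrow> ?t) \<rightarrow> ?p \<rightarrow> (?r \<rightarrow> ?s) \<rightarrow> ?q \<rightarrow> ?t)"
    by (rule derivable_detach[OF 62 60]; code_simp)
  \<comment> \<open>64 to 73 lead to two case distinctions: \<open>?p\<close> against
    \<open>N ?p\<close> (70), and \<open>?p\<close> against \<open>?p \<rightarrow> ?r\<close>
    (73).\<close>
  have 64: "derivable Ds ((?p \<rightarrow> (?q \<rightarrow> ?r) \<rightarrow> ?q) \<rightarrow> ?p \<rightarrow> ?q)"
    by (rule derivable_detach[OF 29 23]; code_simp)
  have 65: "derivable Ds ((?p \<rightarrow> ?q) \<rightarrow> ((?q \<rightarrow> ?r) \<rightarrow> ?p) \<rightarrow> ?q)"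
    by (rule derivable_detach[OF 42 64]; code_simp)
  have 66: "derivable Ds ((?p \<rightarrow> N ?q \<rightarrow> ?q) \<rightarrow> ?p \<rightarrow> ?q)"
    by (rule derivable_detach[OF 29 2]; code_simp)
  have 67: "derivable Ds ((N ?p \<rightarrow> ?q) \<rightarrow> (?q \<rightarrow> ?p) \<rightarrow> ?p)"
    by (rule derivable_detach[OF 5 66]; code_simp)
  have 68: "derivable Ds ((((?p \<rightarrow> ?q) \<rightarrow> ?q) \<rightarrow> ?r) \<rightarrow> (N ?q \<rightarrow> ?p) \<rightarrow> ?r)"
    by (rule derivable_detach[OF 1 67]; code_simp)
  have 69: "derivable Ds (((((?p \<rightarrow> ?q) \<rightarrow> ?r) \<rightarrow> ?p) \<rightarrow> ?s) \<rightarrow> (?r \<rightarrow> ?p) \<rightarrow> ?s)"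
    by (rule derivable_detach[OF 1 65]; code_simp)
  have 70: "derivable Ds ((?p \<rightarrow> ?q) \<rightarrow> (N ?p \<rightarrow> ?q) \<rightarrow> ?q)"
    by (rule derivable_detach[OF 69 68]; code_simp)
  have 71: "derivable Ds (((?p \<rightarrow> ?q) \<rightarrow> ?r) \<rightarrow> (?r \<rightarrow> ?p) \<rightarrow> ?p)"
    by (rule derivable_detach[OF 5 64]; code_simp)
  have 72: "derivable Ds ((((?p \<rightarrow> ?q) \<rightarrow> ?q) \<rightarrow> ?r) \<rightarrow> ((?q \<rightarrow> ?s) \<rightarrow> ?p) \<rightarrow> ?r)"
    by (rule derivable_detach[OF 1 71]; code_simp)
  have 73: "derivable Ds ((?p \<rightarrow> ?q) \<rightarrow> ((?p \<rightarrow> ?r) \<rightarrow> ?q) \<rightarrow> ?q)"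
    by (rule derivable_detach[OF 69 72]; code_simp)
  show "derivable Ds (Var 0 \<rightarrow> Var 0)" by (rule 30)
  show "derivable Ds ((Var 0 \<rightarrow> Var 0) \<rightarrow> Var 0 \<rightarrow> Var 0)" by (rule 32)
  show "derivable Ds (Var 0 \<rightarrow> Var 1 \<rightarrow> Var 0)" by (rule 16)
  show "derivable Ds ((Var 0 \<rightarrow> Var 1) \<rightarrow> (Var 1 \<rightarrow> Var 2) \<rightarrow> Var 0 \<rightarrow> Var 2)" by (rule 1)
  show "derivable Ds ((Var 0 \<rightarrow> Var 1 \<rightarrow> Var 2) \<rightarrow> (Var 0 \<rightarrow> Var 1) \<rightarrow> Var 0 \<rightarrow> Var 2)" by (rule 60)
  show "derivable Ds (Var 0 \<rightarrow> (Var 0 \<rightarrow> Var 1) \<rightarrow> Var 1)" by (rule 26)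
  show "derivable Ds (N (Var 0) \<rightarrow> Var 0 \<rightarrow> Var 1)" by (rule 20)
  show "derivable Ds ((Var 0 \<rightarrow> Var 1) \<rightarrow> (N (Var 0) \<rightarrow> Var 1) \<rightarrow> Var 1)" by (rule 70)
  show "derivable Ds ((Var 0 \<rightarrow> Var 1) \<rightarrow> ((Var 0 \<rightarrow> Var 2) \<rightarrow> Var 1) \<rightarrow> Var 1)" by (rule 73)
  show "derivable Ds (Var 0 \<rightarrow> (Var 1 \<rightarrow> Var 1) \<rightarrow> Var 0)" by (rule 35)
  show "derivable Ds ((Var 0 \<rightarrow> Var 1) \<rightarrow> Var 0 \<rightarrow> Var 2 \<rightarrow> Var 2)" by (rule 36)
  show "derivable Ds ((Var 0 \<rightarrow> Var 1) \<rightarrow> ((Var 2 \<rightarrow> Var 2) \<rightarrow> Var 0) \<rightarrow> Var 1)" by (rule 39)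
  show "derivable Ds ((Var 0 \<rightarrow> Var 1 \<rightarrow> Var 1) \<rightarrow> ((Var 1 \<rightarrow> Var 1) \<rightarrow> Var 0) \<rightarrow> Var 1 \<rightarrow> Var 1)" by (rule 43)
  show "derivable Ds ((Var 0 \<rightarrow> Var 1 \<rightarrow> Var 2) \<rightarrow> Var 0 \<rightarrow> N (Var 2) \<rightarrow> N (Var 1))" by (rule 53)
  show "derivable Ds ((Var 0 \<rightarrow> Var 1 \<rightarrow> Var 2) \<rightarrow> (Var 0 \<rightarrow> Var 3 \<rightarrow> Var 4) \<rightarrow> Var 0 \<rightarrow> (Var 2 \<rightarrow> Var 3) \<rightarrow> Var 1 \<rightarrow> Var 4)" by (rule 63)
qed

section \<open>Substitution and modus ponens\<close>

lemma subforms_refl [simp]: "A \<in> subforms A"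
  by (cases A) auto

lemma subforms_subst: "B \<in> subforms A \<Longrightarrow> subst \<sigma> B \<in> subforms (subst \<sigma> A)"
  by (induction A) auto

lemma axiom_variant_dn_free:
  assumes "axiom_variant {L1, L2, L3} A"
  shows "dn_free A"
proof -
  obtain \<tau> where "subst \<tau> A \<in> {L1, L2, L3}"
    using assms unfolding axiom_variant_def variant_def by auto
  then have "N (N t) \<notin> subforms (subst \<tau> A)" for t
    by (auto simp: L1_def L2_def L3_def)
  then show ?thesis
    unfolding dn_free_iff using subforms_subst[of _ A \<tau>] by fastforce
qed

lemma derivable_dn_ok: "derivable Ds A \<Longrightarrow> dn_ok Ds A"
  by (induction rule: derivable.induct) (auto intro: dn_free_ok axiom_variant_dn_free)

lemma derivable_minor_general:
  assumes "derivable Ds (I (subst \<phi> C) B)" "derivable Ds C"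
  shows "derivable Ds B"
  using derivable.cd[OF assms cd_minor_general] derivable_dn_ok[OF assms(1)] by simp

lemma derivable_mp: "derivable Ds (I A B) \<Longrightarrow> derivable Ds A \<Longrightarrow> derivable Ds B"
  using derivable_minor_general[of Ds Var A B] by simp

lemma derivable_major_general:
  assumes "derivable Ds (I A B)" "derivable Ds (subst \<sigma> A)" "dn_ok Ds (subst \<sigma> B)"
    and "\<forall>x\<in>vars B - vars A. \<sigma> x = Var (f x) \<and> f x \<notin> vars (subst \<sigma> A)"
    and "inj_on f (vars B - vars A)"
  shows "derivable Ds (subst \<sigma> B)"
  using derivable.cd[OF assms(1,2) cd_major_general[OF bspec[OF assms(4)] assms(5)] assms(3)] .

text \<open>
  Condensed detachment yields only most general conclusions, so the coincidence of the
  occurrences of a variable in \<open>A \<rightarrow> A\<close> has to be forced by a derivable antecedent \<open>G\<close>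
  that mentions all of them and is detached at the end.
\<close>

lemma identity_context:
  "\<exists>G. vars G = {..n} \<and> derivable Ds G \<and> (\<forall>x\<le>n. derivable Ds (G \<rightarrow> Var x \<rightarrow> Var x))"
proof (induction n)
  case 0
  show ?case
    by (rule exI[of _ "Var 0 \<rightarrow> Var 0"]) (auto intro: luk_id luk_id_id)
next
  case (Suc n)
  then obtain G where vars: "vars G = {..n}" and G: "derivable Ds G"
    and id: "\<And>x. x \<le> n \<Longrightarrow> derivable Ds (G \<rightarrow> Var x \<rightarrow> Var x)"
    by blast
  have ok: "dn_ok Ds G" using derivable_dn_ok[OF G] .
  let ?v = "Var (Suc n)"
  let ?G = "(?v \<rightarrow> ?v) \<rightarrow> G"
  have "derivable Ds ?G"
    using derivable_major_general[OF luk_weaken, of Ds "Var(0 := G, 1 := ?v)" "\<lambda>_. Suc n"] G ok vars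
    by (simp add: insert_Diff_if)
  moreover have "derivable Ds (?G \<rightarrow> Var x \<rightarrow> Var x)" if "x \<le> n" for x
    using derivable_major_general[OF luk_drop_id, of Ds "Var(0 := G, 1 := Var x \<rightarrow> Var x, 2 := ?v)" "\<lambda>_. Suc n"]
      id[OF that] that ok vars by (simp add: insert_Diff_if)
  moreover have "derivable Ds (?G \<rightarrow> ?v \<rightarrow> ?v)"
  proof -
    \<comment> \<open>\<open>luk_intro_id\<close> replaces the conclusion of an old implication from
      \<open>G\<close> by a fresh identity. \<open>luk_shift_id\<close> then puts the same
      \<open>?v\<close> into the antecedent, tying its occurrences together.\<close>
    have "derivable Ds (G \<rightarrow> ?v \<rightarrow> ?v)"
      using derivable_major_general[OF luk_intro_id, of Ds "Var(0 := G, 1 := Var 0 \<rightarrow> Var 0, 2 := ?v)" "\<lambda>_. Suc n"]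
        id[of 0] ok vars by (simp add: insert_Diff_if)
    then show ?thesis
      using derivable_major_general[OF luk_shift_id, of Ds "Var(0 := G, 1 := ?v)"] ok by simp
  qed
  ultimately have "\<forall>x\<le>Suc n. derivable Ds (?G \<rightarrow> Var x \<rightarrow> Var x)"
    by (simp add: le_Suc_eq)
  moreover have "vars ?G = {..Suc n}" by (simp add: atMost_Suc vars)
  ultimately show ?case using \<open>derivable Ds ?G\<close> by blast
qed

text \<open>Identities of subformulas are combined by monotonicity; the common antecedent
  \<open>G\<close> contains all variables of \<open>A\<close> and keeps them linked until it is
  detached.\<close>

lemma derivable_refl:
  assumes "dn_ok Ds A"
  shows "derivable Ds (A \<rightarrow> A)"
proof -
  obtain n where n: "vars A \<subseteq> {..n}"
    using finite_vars[of A] unfolding finite_nat_set_iff_bounded_le by blast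
  obtain G where vars: "vars G = {..n}" and G: "derivable Ds G"
    and id: "\<And>x. x \<le> n \<Longrightarrow> derivable Ds (G \<rightarrow> Var x \<rightarrow> Var x)"
    using identity_context[of n Ds] by blast
  have okG: "dn_ok Ds G" using derivable_dn_ok[OF G] .
  have "derivable Ds (G \<rightarrow> A \<rightarrow> A)" using assms n
  proof (induction A)
    case (Var x)
    then show ?case using id by simp
  next
    case (N A)
    then have "derivable Ds (G \<rightarrow> A \<rightarrow> A)" using dn_ok_N by auto
    then show ?case
      using derivable_major_general[OF luk_neg_mono, of Ds "Var(0 := G, 1 := A, 2 := A)"]
        N.prems(1) okG by simp
  next
    case (I A B)
    \<comment> \<open>\<open>luk_imp_mono\<close> takes its premisses in turn. After the first, the
      places of \<open>B\<close> are held by two distinct fresh variables, which the second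
      detachment matches to \<open>B\<close>.\<close>
    let ?x = "Var (Suc n)" and ?y = "Var (Suc (Suc n))"
    have A: "derivable Ds (G \<rightarrow> A \<rightarrow> A)" and B: "derivable Ds (G \<rightarrow> B \<rightarrow> B)" using I by auto
    have fresh: "y \<notin> vars G" "y \<notin> vars A" if "y > n" for y
      using that vars I.prems by auto
    have major: "derivable Ds ((G \<rightarrow> ?x \<rightarrow> ?y) \<rightarrow> G \<rightarrow> (A \<rightarrow> ?x) \<rightarrow> A \<rightarrow> ?y)"
      using derivable_major_general[OF luk_imp_mono, of Ds
          "Var(0 := G, 1 := A, 2 := A, 3 := ?x, 4 := ?y)" "\<lambda>x. if x = 3 then Suc n else Suc (Suc n)"]
        A I.prems okG fresh by (simp add: insert_Diff_if)
    let ?\<tau> = "Var(Suc n := B, Suc (Suc n) := B)"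
    have ident: "subst ?\<tau> G = G" "subst ?\<tau> A = A"
      using fresh by (auto intro!: subst_ident)
    have "derivable Ds (subst ?\<tau> (G \<rightarrow> (A \<rightarrow> ?x) \<rightarrow> A \<rightarrow> ?y))"
    proof (rule derivable_major_general[OF major])
      \<comment> \<open>All variables of \<open>A\<close> occur in \<open>G\<close>, so matching the
        antecedent determines the whole conclusion.\<close>
      have no_new: "vars (G \<rightarrow> (A \<rightarrow> ?x) \<rightarrow> A \<rightarrow> ?y) - vars (G \<rightarrow> ?x \<rightarrow> ?y) = {}"
        using vars I.prems by auto
      show "\<forall>x\<in>vars (G \<rightarrow> (A \<rightarrow> ?x) \<rightarrow> A \<rightarrow> ?y) - vars (G \<rightarrow> ?x \<rightarrow> ?y).
          ?\<tau> x = Var (id x) \<and> id x \<notin> vars (subst ?\<tau> (G \<rightarrow> ?x \<rightarrow> ?y))"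
        unfolding no_new by blast
      show "inj_on id (vars (G \<rightarrow> (A \<rightarrow> ?x) \<rightarrow> A \<rightarrow> ?y) - vars (G \<rightarrow> ?x \<rightarrow> ?y))"
        by (rule inj_on_id)
      show "derivable Ds (subst ?\<tau> (G \<rightarrow> ?x \<rightarrow> ?y))"
        using B ident by simp
      show "dn_ok Ds (subst ?\<tau> (G \<rightarrow> (A \<rightarrow> ?x) \<rightarrow> A \<rightarrow> ?y))"
        using okG I.prems ident by simp
    qed
    then show ?case using ident by simp
  qed
  then show ?thesis using G derivable_mp by blast
qed

lemma derivable_subst:
  assumes "derivable Ds A" "dn_ok Ds (subst \<sigma> A)"
  shows "derivable Ds (subst \<sigma> A)"
  using derivable_minor_general[OF derivable_refl[OF assms(2)] assms(1)] .

section \<open>Completeness without new double negations\<close>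

text \<open>Plain modus ponens makes the variables of hypotheses act as constants, so the deduction
  theorem holds. It returns only parts of earlier formulas, hence no side condition.\<close>

inductive entails :: "form set \<Rightarrow> form set \<Rightarrow> form \<Rightarrow> bool" for Ds \<Gamma> where
  hyp: "A \<in> \<Gamma> \<Longrightarrow> entails Ds \<Gamma> A"
| derived: "derivable Ds A \<Longrightarrow> entails Ds \<Gamma> A"
| mp: "entails Ds \<Gamma> (A \<rightarrow> B) \<Longrightarrow> entails Ds \<Gamma> A \<Longrightarrow> entails Ds \<Gamma> B"

lemma entails_const: "dn_ok Ds (A \<rightarrow> B) \<Longrightarrow> entails Ds \<Gamma> (A \<rightarrow> B \<rightarrow> A)"
  using derivable_subst[OF luk_const, of Ds "Var(0 := A, 1 := B)"] by (auto intro: entails.derived)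

lemma entails_trans:
  "dn_ok Ds (A \<rightarrow> B \<rightarrow> C) \<Longrightarrow> entails Ds \<Gamma> ((A \<rightarrow> B) \<rightarrow> (B \<rightarrow> C) \<rightarrow> A \<rightarrow> C)"
  using derivable_subst[OF luk_trans, of Ds "Var(0 := A, 1 := B, 2 := C)"]
  by (auto intro: entails.derived)

lemma entails_distr:
  "dn_ok Ds (A \<rightarrow> B \<rightarrow> C) \<Longrightarrow> entails Ds \<Gamma> ((A \<rightarrow> B \<rightarrow> C) \<rightarrow> (A \<rightarrow> B) \<rightarrow> A \<rightarrow> C)"
  using derivable_subst[OF luk_distr, of Ds "Var(0 := A, 1 := B, 2 := C)"]
  by (auto intro: entails.derived)

lemma entails_apply: "dn_ok Ds (A \<rightarrow> B) \<Longrightarrow> entails Ds \<Gamma> (A \<rightarrow> (A \<rightarrow> B) \<rightarrow> B)"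
  using derivable_subst[OF luk_apply, of Ds "Var(0 := A, 1 := B)"] by (auto intro: entails.derived)

lemma entails_contr: "dn_ok Ds (N A \<rightarrow> B) \<Longrightarrow> entails Ds \<Gamma> (N A \<rightarrow> A \<rightarrow> B)"
  using derivable_subst[OF luk_contr, of Ds "Var(0 := A, 1 := B)"]
  by (auto intro: entails.derived dn_ok_N)

lemma entails_cases:
  "dn_ok Ds (N A \<rightarrow> B) \<Longrightarrow> entails Ds \<Gamma> ((A \<rightarrow> B) \<rightarrow> (N A \<rightarrow> B) \<rightarrow> B)"
  using derivable_subst[OF luk_cases, of Ds "Var(0 := A, 1 := B)"]
  by (auto intro: entails.derived dn_ok_N)

lemma entails_tarski:
  "dn_ok Ds (A \<rightarrow> B \<rightarrow> C) \<Longrightarrow> entails Ds \<Gamma> ((A \<rightarrow> C) \<rightarrow> ((A \<rightarrow> B) \<rightarrow> C) \<rightarrow> C)"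
  using derivable_subst[OF luk_tarski, of Ds "Var(0 := A, 1 := C, 2 := B)"]
  by (auto intro: entails.derived)

lemma entails_syl:
  assumes "entails Ds \<Gamma> (A \<rightarrow> B)" "entails Ds \<Gamma> (B \<rightarrow> C)" "dn_ok Ds (A \<rightarrow> B \<rightarrow> C)"
  shows "entails Ds \<Gamma> (A \<rightarrow> C)"
  using entails.mp[OF entails.mp[OF entails_trans[OF assms(3)] assms(1)] assms(2)] .

lemma entails_dn_ok: "entails Ds \<Gamma> A \<Longrightarrow> \<forall>B\<in>\<Gamma>. dn_ok Ds B \<Longrightarrow> dn_ok Ds A"
  by (induction rule: entails.induct) (auto dest: derivable_dn_ok)

lemma deduction:
  assumes "entails Ds (insert A \<Gamma>) B" and ok: "dn_ok Ds A" "\<forall>C\<in>\<Gamma>. dn_ok Ds C"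
  shows "entails Ds \<Gamma> (A \<rightarrow> B)"
  using assms(1)
proof (induction rule: entails.induct)
  case (hyp B)
  then show ?case
    using ok entails.mp[OF entails_const entails.hyp, of Ds B A \<Gamma>]
    by (auto intro: entails.derived derivable_refl)
next
  case (derived B)
  then show ?case
    using ok entails.mp[OF entails_const entails.derived, of Ds B A \<Gamma>] derivable_dn_ok[of Ds B] by simp
next
  case (mp B C)
  \<comment> \<open>The cut formula \<open>B\<close> is absent from the conclusion; its
    admissibility comes from being entailed.\<close>
  then have "dn_ok Ds (B \<rightarrow> C)" using ok by (auto dest: entails_dn_ok)
  then have "entails Ds \<Gamma> ((A \<rightarrow> B \<rightarrow> C) \<rightarrow> (A \<rightarrow> B) \<rightarrow> A \<rightarrow> C)" using ok entails_distr by simp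
  then show ?case using mp.IH entails.mp by blast
qed

section \<open>Truth values and Kalmar's argument relative to \<open>C\<close>\<close>

primrec eval :: "(nat \<Rightarrow> bool) \<Rightarrow> form \<Rightarrow> bool" where
  "eval v (Var x) = v x"
| "eval v (I A B) = (eval v A \<longrightarrow> eval v B)"
| "eval v (N A) = (\<not> eval v A)"

definition literal :: "form \<Rightarrow> (nat \<Rightarrow> bool) \<Rightarrow> nat \<Rightarrow> form" where
  "literal C v x = (if v x then Var x else Var x \<rightarrow> C)"

text \<open>Truth is encoded by \<open>(A \<rightarrow> C) \<rightarrow> C\<close> rather than
  \<open>A\<close>: a false \<open>A\<close> provides only \<open>A \<rightarrow> C\<close>, which
  does not give \<open>A \<rightarrow> B\<close> itself but does give its double negation relative
  to \<open>C\<close>.\<close>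

lemma kalmar:
  assumes "dn_ok Ds A" "vars A \<subseteq> V" and C: "dn_ok Ds C"
  shows "(eval v A \<longrightarrow> entails Ds (literal C v ` V) ((A \<rightarrow> C) \<rightarrow> C)) \<and>
    (\<not> eval v A \<longrightarrow> entails Ds (literal C v ` V) (A \<rightarrow> C))"
  using assms(1,2)
proof (induction A)
  case (Var x)
  let ?\<Gamma> = "literal C v ` V"
  have "entails Ds ?\<Gamma> (literal C v x)" using Var by (auto intro: entails.hyp)
  then show ?case
    using entails.mp[OF entails_apply, of Ds "Var x" C ?\<Gamma>] C
    by (cases "v x") (simp_all add: literal_def[of C v x])
next
  case (I A B)
  let ?\<Gamma> = "literal C v ` V"
  have ok: "dn_ok Ds A" "dn_ok Ds B" and
    IH: "eval v A \<Longrightarrow> entails Ds ?\<Gamma> ((A \<rightarrow> C) \<rightarrow> C)" "\<not> eval v A \<Longrightarrow> entails Ds ?\<Gamma> (A \<rightarrow> C)"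
      "eval v B \<Longrightarrow> entails Ds ?\<Gamma> ((B \<rightarrow> C) \<rightarrow> C)" "\<not> eval v B \<Longrightarrow> entails Ds ?\<Gamma> (B \<rightarrow> C)"
    using I by auto
  \<comment> \<open>Classically \<open>A\<close> or \<open>A \<rightarrow> B\<close> holds, and each
    is assumed to imply \<open>C\<close>.\<close>
  have "entails Ds ?\<Gamma> (((A \<rightarrow> B) \<rightarrow> C) \<rightarrow> C)" if "\<not> eval v A"
    using entails.mp[OF entails_tarski IH(2)[OF that], of B] ok C by simp
  moreover have "entails Ds ?\<Gamma> (((A \<rightarrow> B) \<rightarrow> C) \<rightarrow> C)" if "eval v B"
  proof -
    have "entails Ds ?\<Gamma> (B \<rightarrow> A \<rightarrow> B)" using entails_const ok by simp
    then have "entails Ds ?\<Gamma> (((A \<rightarrow> B) \<rightarrow> C) \<rightarrow> B \<rightarrow> C)"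
      using entails.mp[OF entails_trans] ok C by simp
    then show ?thesis using entails_syl[OF _ IH(3)[OF that]] ok C by simp
  qed
  moreover have "entails Ds ?\<Gamma> ((A \<rightarrow> B) \<rightarrow> C)" if "eval v A" "\<not> eval v B"
  proof -
    have "entails Ds ?\<Gamma> ((A \<rightarrow> B) \<rightarrow> (B \<rightarrow> C) \<rightarrow> A \<rightarrow> C)"
      using entails_trans ok C by simp
    moreover have "entails Ds ?\<Gamma> ((A \<rightarrow> B) \<rightarrow> B \<rightarrow> C)"
      using entails.mp[OF entails_const IH(4)[OF that(2)], of "A \<rightarrow> B"] ok C by simp
    ultimately have "entails Ds ?\<Gamma> ((A \<rightarrow> B) \<rightarrow> A \<rightarrow> C)"
      using entails.mp[OF entails.mp[OF entails_distr], of Ds "A \<rightarrow> B" "B \<rightarrow> C" "A \<rightarrow> C" ?\<Gamma>] ok C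
      by simp
    then show ?thesis using entails_syl[OF _ IH(1)[OF that(1)]] ok C by simp
  qed
  ultimately show ?case by auto
next
  case (N A)
  let ?\<Gamma> = "literal C v ` V"
  have ok: "dn_ok Ds A" "dn_ok Ds (N A)"
    using N.prems dn_ok_N by auto
  with N have IH: "eval v A \<Longrightarrow> entails Ds ?\<Gamma> ((A \<rightarrow> C) \<rightarrow> C)" "\<not> eval v A \<Longrightarrow> entails Ds ?\<Gamma> (A \<rightarrow> C)"
    by auto
  have "entails Ds ?\<Gamma> (N A \<rightarrow> C)" if "eval v A"
    using entails_syl[OF entails_contr IH(1)[OF that]] ok C by simp
  \<comment> \<open>Case distinction on \<open>A\<close>: both \<open>A\<close> and
    \<open>N A\<close> lead to \<open>C\<close>.\<close>
  moreover have "entails Ds ?\<Gamma> ((N A \<rightarrow> C) \<rightarrow> C)" if "\<not> eval v A"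
    using entails.mp[OF entails_cases IH(2)[OF that]] ok C by simp
  ultimately show ?case by simp
qed

text \<open>The two literals of \<open>x\<close> discharge to \<open>Var x \<rightarrow> C\<close>
  and \<open>(Var x \<rightarrow> C) \<rightarrow> C\<close>, and the second applies to the
  first.\<close>

lemma discharge_literals:
  assumes "finite V" "dn_ok Ds C" "\<And>v. entails Ds (literal C v ` V) C"
  shows "entails Ds {} C"
  using assms(1,3)
proof (induction V rule: finite_induct)
  case empty
  then show ?case by simp
next
  case (insert x V)
  show ?case
  proof (rule insert.IH)
    fix v
    let ?\<Gamma> = "literal C v ` V"
    have ok: "\<forall>B\<in>?\<Gamma>. dn_ok Ds B" using assms(2) by (auto simp: literal_def)
    have "literal C (v(x := b)) ` V = ?\<Gamma>" for b
      using insert.hyps(2) by (auto simp: literal_def)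
    then have "entails Ds (insert (Var x) ?\<Gamma>) C" "entails Ds (insert (Var x \<rightarrow> C) ?\<Gamma>) C"
      using insert.prems[of "v(x := True)"] insert.prems[of "v(x := False)"]
      by (simp_all add: literal_def)
    then have "entails Ds ?\<Gamma> (Var x \<rightarrow> C)" "entails Ds ?\<Gamma> ((Var x \<rightarrow> C) \<rightarrow> C)"
      using deduction ok assms(2) by simp_all
    then show "entails Ds ?\<Gamma> C" using entails.mp by blast
  qed
qed

theorem tautology_derivable:
  assumes "\<And>v. eval v A" "dn_ok Ds A"
  shows "derivable Ds A"
proof -
  have "entails Ds (literal A v ` vars A) A" for v
  proof -
    \<comment> \<open>With \<open>C\<close> chosen as \<open>A\<close>, relative truth of
      \<open>A\<close> has the derivable antecedent \<open>A \<rightarrow> A\<close>.\<close>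
    have "entails Ds (literal A v ` vars A) ((A \<rightarrow> A) \<rightarrow> A)"
      using kalmar[of Ds A "vars A" A v] assms by simp
    then show ?thesis
      using entails.mp entails.derived[OF derivable_refl[OF assms(2)]] by blast
  qed
  then have "entails Ds {} A" using discharge_literals[of "vars A"] assms(2) by simp
  then show ?thesis
    by (induction rule: entails.induct) (auto intro: derivable_mp)
qed

section \<open>Soundness and conclusion\<close>

lemma eval_subst: "eval v (subst \<sigma> A) = eval (\<lambda>x. eval v (\<sigma> x)) A"
  by (induction A) auto

lemma variant_taut: "variant A B \<Longrightarrow> (\<And>v. eval v A) \<Longrightarrow> eval v B"
  unfolding variant_def using eval_subst by metis

lemma variant_sym: "variant A B \<Longrightarrow> variant B A"
  unfolding variant_def by blast

lemma cd_taut: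
  assumes "cd M m R" "\<And>v. eval v M" "\<And>v. eval v m"
  shows "eval v R"
proof -
  obtain A B C \<sigma> where "variant (I A B) M" "variant C m" and mgu: "is_mgu \<sigma> A C"
    and R: "variant R (subst \<sigma> B)"
    using assms(1) unfolding cd_def by blast
  then have AB: "eval w (I A B)" and C: "eval w C" for w
    using variant_taut[OF variant_sym] assms(2,3) by blast+
  have "eval w (subst \<sigma> B)" for w
    \<comment> \<open>Under the composed valuation the premisses are read as their
      \<open>\<sigma>\<close>-instances, where antecedent and minor premiss coincide.\<close>
    using AB[of "\<lambda>x. eval w (\<sigma> x)"] C[of "\<lambda>x. eval w (\<sigma> x)"] mgu
    unfolding is_mgu_def by (metis eval.simps(2) eval_subst)
  then show ?thesis using variant_taut[OF variant_sym[OF R]] by blast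
qed

lemma axiom_taut:
  assumes "axiom_variant {L1, L2, L3} A"
  shows "eval v A"
proof -
  obtain L where L: "L \<in> {L1, L2, L3}" "variant L A"
    using assms variant_sym unfolding axiom_variant_def by blast
  then have "eval w L" for w by (auto simp: L1_def L2_def L3_def)
  then show ?thesis using variant_taut[OF L(2)] by blast
qed

lemma provable_taut:
  assumes "provable {L1, L2, L3} A"
  shows "eval v A"
proof -
  obtain ps where ps: "is_proof {L1, L2, L3} ps" "ps \<noteq> []" "last ps = A"
    using assms unfolding provable_def by blast
  have "\<forall>v. eval v (ps ! i)" if "i < length ps" for i
    using that
  proof (induction i rule: less_induct)
    case (less i)
    then consider "axiom_variant {L1, L2, L3} (ps ! i)"
      | j k where "j < i" "k < i" "cd (ps ! j) (ps ! k) (ps ! i)"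
      using ps(1) unfolding is_proof_def by blast
    then show ?case
    proof cases
      case 1
      then show ?thesis using axiom_taut by blast
    next
      case 2
      then show ?thesis using cd_taut less by (meson less_trans)
    qed
  qed
  then have "\<forall>v. eval v (ps ! (length ps - 1))" using ps(2) by simp
  then show ?thesis using ps(2,3) by (simp add: last_conv_nth)
qed

text \<open>This transfers tautology from \<open>B\<close> to \<open>dn_star S B\<close> for any
  selection \<open>S\<close>.\<close>

lemma eval_dn_star: "eval v (dn_star S A) = eval v A"
  by (induction S A rule: dn_star.induct) auto

section \<open>From derivation trees to proof lists\<close>

text \<open>Trading indices for membership lets proofs be concatenated without shifting
  positions.\<close>

lemma is_proof_snoc:
  "is_proof Ax (ps @ [R]) \<longleftrightarrow>
     is_proof Ax ps \<and> (axiom_variant Ax R \<or> (\<exists>M\<in>set ps. \<exists>m\<in>set ps. cd M m R))"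
proof -
  have "(\<exists>j k. j < i \<and> k < i \<and> cd ((ps @ [R]) ! j) ((ps @ [R]) ! k) B) \<longleftrightarrow>
      (\<exists>j k. j < i \<and> k < i \<and> cd (ps ! j) (ps ! k) B)" if "i \<le> length ps" for i B
    using that by (auto simp: nth_append cong: conj_cong)
  moreover have "(\<exists>j k. j < length ps \<and> k < length ps \<and> cd (ps ! j) (ps ! k) R) \<longleftrightarrow>
      (\<exists>M\<in>set ps. \<exists>m\<in>set ps. cd M m R)"
    by (force simp: in_set_conv_nth)
  ultimately show ?thesis
    unfolding is_proof_def by (simp add: All_less_Suc nth_append conj_commute)
qed

lemma is_proof_append:
  assumes "is_proof Ax ps" "is_proof Ax qs"
  shows "is_proof Ax (ps @ qs)"
  using assms(2)
proof (induction qs rule: rev_induct)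
  case Nil
  then show ?case using assms(1) by simp
next
  case (snoc R qs)
  then show ?case unfolding append_assoc[symmetric] is_proof_snoc by auto
qed

lemma derivable_proof:
  "derivable Ds A \<Longrightarrow> \<exists>ps. is_proof {L1, L2, L3} ps \<and> ps \<noteq> [] \<and> last ps = A \<and> (\<forall>B\<in>set ps. dn_ok Ds B)"
proof (induction rule: derivable.induct)
  case (ax A)
  then show ?case
    using dn_free_ok[OF axiom_variant_dn_free]
    by (intro exI[of _ "[A]"]) (auto simp: is_proof_def)
next
  case (cd M m R)
  then obtain ps qs where
    ps: "is_proof {L1, L2, L3} ps" "ps \<noteq> []" "last ps = M" "\<forall>B\<in>set ps. dn_ok Ds B" and
    qs: "is_proof {L1, L2, L3} qs" "qs \<noteq> []" "last qs = m" "\<forall>B\<in>set qs. dn_ok Ds B"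
    by blast
  then have "M \<in> set (ps @ qs)" "m \<in> set (ps @ qs)" by auto
  then have "is_proof {L1, L2, L3} ((ps @ qs) @ [R])"
    using is_proof_append[OF ps(1) qs(1)] cd.hyps(3) unfolding is_proof_snoc by blast
  then show ?case
    using ps(4) qs(4) cd.hyps(4) by (intro exI[of _ "(ps @ qs) @ [R]"]) auto
qed

theorem theorem5:
  shows "admits_strong_dne {L1, L2, L3}"
  unfolding admits_strong_dne_def
proof (intro allI impI)
  fix B S
  assume "provable {L1, L2, L3} B"
  let ?C = "dn_star S B"
  \<comment> \<open>With \<open>Ds\<close> the subformulas of the target, each double negation in
    the target is a variant of itself.\<close>
  have "dn_ok (subforms ?C) ?C"
    unfolding dn_ok_def using variant_refl by blast
  then have "derivable (subforms ?C) ?C"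
    using provable_taut[OF \<open>provable {L1, L2, L3} B\<close>] by (intro tautology_derivable) (simp_all add: eval_dn_star)
  from derivable_proof[OF this]
  show "\<exists>ps. is_proof {L1, L2, L3} ps \<and> ps \<noteq> [] \<and> last ps = ?C \<and>
      (\<forall>i<length ps. \<not> axiom_variant {L1, L2, L3} (ps ! i) \<longrightarrow>
        (\<forall>t. N (N t) \<in> subforms (ps ! i) \<longrightarrow> (\<exists>s\<in>subforms ?C. variant s (N (N t)))))"
    unfolding dn_ok_def by (metis nth_mem)
qed

end
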